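(* Let $m\ge 1$, $n\ge 1$ be integers, $N=m+n$, and $0<s<1$. Then there exists a unique $\alpha=\alpha(s,m,n)>0$ such that the cone $C_\alpha=\{(y,z)\in\mathbb{R}^m\times\mathbb{R}^n : |z|=\alpha|y|\}$ is a nonlocal minimal cone, i.e. $H^s_{C_\alpha}(p)=0$ for every $p\in C_\alpha\setminus\{0\}$, where $C_\alpha=\partial E_\alpha$ with $E_\alpha=\{(y,z): |z|>\alpha|y|\}$.
   Context: For an open set $E\subset\mathbb{R}^N$ with boundary $\Sigma=\partial E$ regular near $p\in\Sigma$, the nonlocal ($s$-)mean curvature is $H^s_\Sigma(p)=\mathrm{p.v.}\int_{\mathbb{R}^N}\frac{\chi_E(x)-\chi_{\mathbb{R}^N\setminus E}(x)}{|x-p|^{N+s}}\,dx=\lim_{\delta\to0}\int_{|x-p|>\delta}\frac{\chi_E(x)-\chi_{\mathbb{R}^N\setminus E}(x)}{|x-p|^{N+s}}\,dx$. The resulting cone is denoted $C^n_m(s)$. *)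

theory Defs
  imports "HOL-Analysis.Analysis"
begin

definition nmc_kernel :: "real \<Rightarrow> 'a::euclidean_space set \<Rightarrow> 'a \<Rightarrow> 'a \<Rightarrow> real" where
  "nmc_kernel s E p x =
     (indicator E x - indicator (- E) x) / (dist x p) powr (real DIM('a) + s)"

definition nmc_trunc :: "real \<Rightarrow> 'a::euclidean_space set \<Rightarrow> 'a \<Rightarrow> real \<Rightarrow> real" where
  "nmc_trunc s E p \<delta> = (LINT x : {x. \<delta> < dist x p} | lborel. nmc_kernel s E p x)"

definition has_nonlocal_mean_curvature ::
  "real \<Rightarrow> 'a::euclidean_space set \<Rightarrow> 'a \<Rightarrow> real \<Rightarrow> bool" where
  "has_nonlocal_mean_curvature s E p H \<longleftrightarrow>
     (\<forall>\<delta>>0. set_integrable lborel {x. \<delta> < dist x p} (nmc_kernel s E p)) \<and>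
     ((nmc_trunc s E p) \<longlongrightarrow> H) (at_right 0)"

definition cone_set :: "real \<Rightarrow> ((real^'m) \<times> (real^'n)) set" where
  "cone_set \<alpha> = {(y, z). norm z > \<alpha> * norm y}"

definition cone :: "real \<Rightarrow> ((real^'m) \<times> (real^'n)) set" where
  "cone \<alpha> = {(y, z). norm z = \<alpha> * norm y}"

end

theory Submission
  imports Defs
begin

text \<open>
  Fix basis vectors \<open>e\<close>, \<open>f\<close> of the two factors. A rotation in the plane spanned by them moves a
  boundary point of the cone with slope \<open>t\<close> to \<open>(e, 0)\<close> and its boundary line to the \<open>e\<close>-axis.
  With \<open>u = y \<bullet> e\<close> and \<open>v = z \<bullet> f\<close>, the rotated set is
  \<open>2uv + |z|\<^sup>2/t - t(|y|\<^sup>2 - u\<^sup>2 + v\<^sup>2) > 0\<close>, which shrinks strictly as \<open>t\<close> grows although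
  the boundary point stays fixed. Hence the curvature at \<open>(e, 0)\<close> is strictly decreasing in \<open>t\<close>,
  which gives uniqueness.

  Averaging the kernel over \<open>v \<mapsto> -v\<close> leaves, near \<open>(e, 0)\<close>, only the region \<open>|v| \<le> C r\<^sup>2\<close>,
  on which \<open>r powr -(N+s)\<close> is integrable because \<open>s < 1\<close>; so the principal value is an absolutely
  convergent integral. It is continuous in \<open>t\<close> by dominated convergence, monotonicity providing the
  majorant. As \<open>t\<close> tends to \<open>0\<close> (to infinity) the averaged kernel increases to
  \<open>r powr -(N+s)\<close> (decreases to its negative), which is not integrable, so by monotone convergence the
  curvature takes both signs.
\<close>

section \<open>Lebesgue measure under similarities\<close>

text \<open>
  As in the uniqueness proof of Haar measure, \<open>|T\<^sup>-\<^sup>1 A| |B|\<close> for the unit ball \<open>B\<close> is computed by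
  Fubini and translation invariance; this avoids determinants, which the library has for \<open>real ^ 'n\<close> only.
\<close>
lemma emeasure_similarity_vimage:
  fixes T :: "'a::euclidean_space \<Rightarrow> 'a"
  assumes T: "linear T" and c: "c > 0" and norm: "\<And>x. norm (T x) = c * norm x"
    and A: "A \<in> sets borel"
  shows "emeasure lborel (T -` A) = ennreal (1 / c ^ DIM('a)) * emeasure lborel A"
proof -
  let ?B = "ball 0 1 :: 'a set"
  have [measurable]: "?B \<in> sets borel" by simp
  have inj: "inj T"
    using T c norm by (metis linear_injective_0 mult_eq_0_iff norm_eq_zero order_less_irrefl)
  then have surj: "surj T"
    using T linear_injective_imp_surjective by blast
  have [measurable]: "T \<in> borel_measurable borel"
    by (intro borel_measurable_continuous_onI linear_continuous_on linear_conv_bounded_linear[THEN iffD1] T)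
  note A[measurable]
  \<comment> \<open>A shift by \<open>y = T v\<close> of the image is a shift of \<open>w\<close> by
    \<open>v\<close>, so the map \<open>T\<close> inherits translation invariance from Lebesgue
    measure.\<close>
  have shift: "(\<integral>\<^sup>+w. h (T w) \<partial>lborel) = (\<integral>\<^sup>+w. h (T w + y) \<partial>lborel)"
    if [measurable]: "h \<in> borel_measurable borel" for h :: "'a \<Rightarrow> ennreal" and y
  proof -
    obtain v where v: "y = T v" using surj by (metis surjD)
    have "(\<integral>\<^sup>+w. h (T w) \<partial>lborel) = (\<integral>\<^sup>+w. h (T w) \<partial>distr lborel borel ((+) v))"
      by (simp add: lborel_distr_plus)
    also have "\<dots> = (\<integral>\<^sup>+w. h (T w + y) \<partial>lborel)"
      by (subst nn_integral_distr) (auto simp: v linear_add[OF T] add.commute)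
    finally show ?thesis .
  qed
  have vB: "T -` ?B = ball 0 (1 / c)"
    using c norm by (auto simp: field_simps)
  have ball: "emeasure lborel (ball x 1) = ennreal (unit_ball_vol (real DIM('a)))" for x :: 'a
    by (simp add: emeasure_ball)
  have vimage: "(\<integral>\<^sup>+w. indicator C (T w) \<partial>lborel) = emeasure lborel (T -` C)" if "C \<in> sets borel" for C
    using measurable_sets_borel[OF \<open>T \<in> borel_measurable borel\<close> that]
    by (simp add: indicator_vimage[symmetric])
  have B0: "emeasure lborel ?B \<noteq> 0"
  proof -
    have "0 < unit_ball_vol (real DIM('a))" by (rule unit_ball_vol_pos) simp
    then show ?thesis unfolding ball by (simp only: ennreal_eq_0_iff not_le)
  qed
  have scale: "emeasure lborel (T -` ?B) = ennreal (1 / c ^ DIM('a)) * emeasure lborel ?B"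
    using c by (simp add: vB emeasure_ball power_divide ennreal_mult[symmetric])
  \<comment> \<open>After exchanging the integrals, the shift by \<open>y\<close> moves the variable
    from the factor of \<open>?B\<close> into the factor of \<open>A\<close>; integrating over
    \<open>y\<close> then releases the measure of \<open>A\<close> and leaves that of the preimage
    of \<open>?B\<close>, which is an explicit ball.\<close>
  have "emeasure lborel (T -` A) * emeasure lborel ?B
      = (\<integral>\<^sup>+w. indicator A (T w) * emeasure lborel ?B \<partial>lborel)"
    by (subst nn_integral_multc) (auto simp: vimage A)
  also have "\<dots> = (\<integral>\<^sup>+w. \<integral>\<^sup>+y. indicator A (T w) * indicator ?B (T w - y) \<partial>lborel \<partial>lborel)"
  proof (intro nn_integral_cong)
    fix w
    have "(\<integral>\<^sup>+y. indicator ?B (T w - y) \<partial>lborel) = (\<integral>\<^sup>+y. indicator (ball (T w) 1) y \<partial>lborel)"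
      by (intro nn_integral_cong) (auto simp: indicator_def dist_norm norm_minus_commute)
    then have "(\<integral>\<^sup>+y. indicator ?B (T w - y) \<partial>lborel) = emeasure lborel ?B"
      by (simp add: ball)
    moreover have "(\<lambda>y. indicator ?B (T w - y) :: ennreal) \<in> borel_measurable lborel"
      by measurable
    ultimately show "indicator A (T w) * emeasure lborel ?B = (\<integral>\<^sup>+y. indicator A (T w) * indicator ?B (T w - y) \<partial>lborel)"
      by (subst nn_integral_cmult) simp_all
  qed
  also have "\<dots> = (\<integral>\<^sup>+y. \<integral>\<^sup>+w. indicator A (T w) * indicator ?B (T w - y) \<partial>lborel \<partial>lborel)"
    by (rule lborel_pair.Fubini') measurable
  also have "\<dots> = (\<integral>\<^sup>+y. \<integral>\<^sup>+w. indicator A (T w + y) * indicator ?B (T w) \<partial>lborel \<partial>lborel)"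
    using shift[of "\<lambda>x. indicator A x * indicator ?B (x - y)" y for y] by simp
  also have "\<dots> = (\<integral>\<^sup>+w. \<integral>\<^sup>+y. indicator A (T w + y) * indicator ?B (T w) \<partial>lborel \<partial>lborel)"
    by (rule lborel_pair.Fubini') measurable
  also have "\<dots> = (\<integral>\<^sup>+w. emeasure lborel A * indicator ?B (T w) \<partial>lborel)"
  proof (intro nn_integral_cong)
    fix w
    have "emeasure lborel A = (\<integral>\<^sup>+y. indicator A y \<partial>distr lborel borel ((+) (T w)))"
      by (simp add: lborel_distr_plus)
    also have "\<dots> = (\<integral>\<^sup>+y. indicator A (T w + y) \<partial>lborel)"
      by (subst nn_integral_distr) auto
    finally show "(\<integral>\<^sup>+y. indicator A (T w + y) * indicator ?B (T w) \<partial>lborel) = emeasure lborel A * indicator ?B (T w)"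
      by (subst nn_integral_multc) auto
  qed
  also have "\<dots> = emeasure lborel A * emeasure lborel (T -` ?B)"
    by (subst nn_integral_cmult) (auto simp: vimage)
  also have "\<dots> = emeasure lborel A * ennreal (1 / c ^ DIM('a)) * emeasure lborel ?B"
    by (simp add: scale mult.assoc)
  finally have "emeasure lborel (T -` A) * emeasure lborel ?B / emeasure lborel ?B
    = emeasure lborel A * ennreal (1 / c ^ DIM('a)) * emeasure lborel ?B / emeasure lborel ?B"
    by (rule arg_cong)
  moreover have Bt: "emeasure lborel ?B \<noteq> top"
    using emeasure_lborel_ball_finite[of "0::'a" 1] by (simp add: less_top)
  ultimately show ?thesis
    by (simp only: ennreal_mult_divide_eq[OF B0 Bt] mult.commute[of "emeasure lborel A"])
qed

lemma lborel_distr_similarity: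
  fixes T :: "'a::euclidean_space \<Rightarrow> 'a"
  assumes T: "linear T" and c: "c > 0" and norm: "\<And>x. norm (T x) = c * norm x"
  shows "distr lborel borel T = density lborel (\<lambda>_. ennreal (1 / c ^ DIM('a)))"
proof (rule measure_eqI)
  fix A assume "A \<in> sets (distr lborel borel T)"
  moreover have "T \<in> borel_measurable borel"
    by (intro borel_measurable_continuous_onI linear_continuous_on linear_conv_bounded_linear[THEN iffD1] T)
  ultimately show "emeasure (distr lborel borel T) A
      = emeasure (density lborel (\<lambda>_. ennreal (1 / c ^ DIM('a)))) A"
    using emeasure_similarity_vimage[OF assms]
    by (simp add: emeasure_distr emeasure_density nn_integral_cmult)
qed simp

lemma
  fixes T :: "'a::euclidean_space \<Rightarrow> 'a" and F :: "'a \<Rightarrow> real"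
  assumes T: "linear T" and c: "c > 0" and norm: "\<And>x. norm (T x) = c * norm x"
    and F: "F \<in> borel_measurable borel"
  shows integrable_similarity: "integrable lborel (\<lambda>x. F (T x)) \<longleftrightarrow> integrable lborel F"
    and integral_similarity: "(LINT x|lborel. F (T x)) = (LINT x|lborel. F x) / c ^ DIM('a)"
proof -
  have [measurable]: "T \<in> borel_measurable borel"
    by (intro borel_measurable_continuous_onI linear_continuous_on linear_conv_bounded_linear[THEN iffD1] T)
  note F[measurable]
  have "integrable lborel (\<lambda>x. F (T x)) \<longleftrightarrow> integrable (distr lborel borel T) F"
    by (subst integrable_distr_eq) auto
  also have "\<dots> \<longleftrightarrow> integrable lborel F"
    unfolding lborel_distr_similarity[OF T c norm] using c
    by (subst integrable_density) (auto simp: divide_inverse)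
  finally show "integrable lborel (\<lambda>x. F (T x)) \<longleftrightarrow> integrable lborel F" .
  have "(LINT x|lborel. F (T x)) = (LINT x|distr lborel borel T. F x)"
    by (subst integral_distr) auto
  also have "\<dots> = (LINT x|lborel. F x) / c ^ DIM('a)"
    unfolding lborel_distr_similarity[OF T c norm] using c
    by (subst integral_density) auto
  finally show "(LINT x|lborel. F (T x)) = (LINT x|lborel. F x) / c ^ DIM('a)" .
qed

section \<open>Integrability of powers of the distance\<close>

text \<open>Layer-cake: \<open>r powr -q\<close> is the integral of \<open>q \<tau> powr (-q-1)\<close> over \<open>\<tau> \<ge> r\<close>.\<close>
lemma nn_integral_inverse_dist_powr_le:
  fixes p :: "'a::euclidean_space"
  assumes D: "D \<in> sets borel" and q: "q > 0" and h: "h \<in> borel_measurable borel"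
    and le: "\<And>\<tau>. \<tau> > 0 \<Longrightarrow> emeasure lborel (D \<inter> cball p \<tau>) \<le> h \<tau>"
  shows "(\<integral>\<^sup>+x. ennreal (1 / dist x p powr q) * indicator D x \<partial>lborel)
     \<le> (\<integral>\<^sup>+\<tau>. ennreal (q * \<tau> powr (-q-1)) * h \<tau> * indicator {0<..} \<tau> \<partial>lborel)"
proof -
  note [measurable] = D h
  let ?k = "\<lambda>\<tau>. ennreal (q * \<tau> powr (-q-1))"
  let ?f = "\<lambda>x \<tau>. ?k \<tau> * indicator D x * (if 0 < \<tau> \<and> dist x p \<le> \<tau> then 1 else 0)"
  have layer: "ennreal (1 / dist x p powr q) \<le> (\<integral>\<^sup>+\<tau>. ?k \<tau> * (if 0 < \<tau> \<and> dist x p \<le> \<tau> then 1 else 0) \<partial>lborel)" for x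
  proof (cases "x = p")
    case False
    then have r: "dist x p > 0" by simp
    have "((\<lambda>\<tau>. q * \<tau> powr (-q-1)) has_integral q * (-(dist x p powr (-q-1+1)) / (-q-1+1))) {dist x p..}"
      using q r by (intro has_integral_mult_right has_integral_powr_to_inf) auto
    then have "((\<lambda>\<tau>. if \<tau> \<in> {dist x p..} then q * \<tau> powr (-q-1) else 0) has_integral 1 / dist x p powr q) UNIV"
      using q by (subst has_integral_restrict_UNIV) (simp add: powr_minus field_simps)
    then have "(\<integral>\<^sup>+\<tau>. ennreal (if \<tau> \<in> {dist x p..} then q * \<tau> powr (-q-1) else 0) \<partial>lborel) = ennreal (1 / dist x p powr q)"
      using q by (intro nn_integral_has_integral_lborel) auto
    moreover have "(\<integral>\<^sup>+\<tau>. ennreal (if \<tau> \<in> {dist x p..} then q * \<tau> powr (-q-1) else 0) \<partial>lborel)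
       = (\<integral>\<^sup>+\<tau>. ?k \<tau> * (if 0 < \<tau> \<and> dist x p \<le> \<tau> then 1 else 0) \<partial>lborel)"
      using less_le_trans[OF r] by (intro nn_integral_cong) auto
    ultimately show ?thesis by simp
  qed (use q in simp)
  have "(\<integral>\<^sup>+x. ennreal (1 / dist x p powr q) * indicator D x \<partial>lborel) \<le> (\<integral>\<^sup>+x. \<integral>\<^sup>+\<tau>. ?f x \<tau> \<partial>lborel \<partial>lborel)"
    using layer by (intro nn_integral_mono) (auto simp: indicator_def)
  also have "\<dots> = (\<integral>\<^sup>+\<tau>. \<integral>\<^sup>+x. ?f x \<tau> \<partial>lborel \<partial>lborel)"
    by (rule lborel_pair.Fubini'[symmetric]) measurable
  also have "\<dots> \<le> (\<integral>\<^sup>+\<tau>. ?k \<tau> * h \<tau> * indicator {0<..} \<tau> \<partial>lborel)"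
  proof (intro nn_integral_mono)
    fix \<tau> :: real
    have "(\<integral>\<^sup>+x. ?f x \<tau> \<partial>lborel) = (\<integral>\<^sup>+x. (?k \<tau> * indicator {0<..} \<tau>) * indicator (D \<inter> cball p \<tau>) x \<partial>lborel)"
      by (intro nn_integral_cong) (auto simp: indicator_def dist_commute)
    also have "\<dots> = (?k \<tau> * indicator {0<..} \<tau>) * emeasure lborel (D \<inter> cball p \<tau>)"
      using D by (subst nn_integral_cmult) (auto intro!: borel_measurable_indicator)
    also have "\<dots> \<le> ?k \<tau> * h \<tau> * indicator {0<..} \<tau>"
      using le[of \<tau>] by (auto simp: indicator_def intro!: mult_left_mono)
    finally show "(\<integral>\<^sup>+x. ?f x \<tau> \<partial>lborel) \<le> ?k \<tau> * h \<tau> * indicator {0<..} \<tau>" .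
  qed
  finally show ?thesis .
qed

lemma set_integrable_nonnegI:
  fixes f :: "'a \<Rightarrow> real"
  assumes "f \<in> borel_measurable M" "D \<in> sets M" "\<And>x. f x \<ge> 0"
    and "(\<integral>\<^sup>+x. ennreal (f x) * indicator D x \<partial>M) < \<infinity>"
  shows "set_integrable M D f"
proof -
  have "(\<integral>\<^sup>+x. ennreal (indicator D x *\<^sub>R f x) \<partial>M) = (\<integral>\<^sup>+x. ennreal (f x) * indicator D x \<partial>M)"
    by (intro nn_integral_cong) (simp split: split_indicator)
  with assms show ?thesis
    unfolding set_integrable_def by (intro integrableI_nonneg) auto
qed

text \<open>Balls have volume of order \<open>\<tau> ^ DIM('a)\<close>, so the layer-cake integrand
  is a multiple of \<open>\<tau> powr (-s-1)\<close>. It starts only at \<delta>, since smaller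
  balls miss the set, and is integrable at infinity because \<open>s > 0\<close>.\<close>

lemma integrable_inverse_dist_powr_far:
  fixes p :: "'a::euclidean_space"
  assumes s: "s > 0" and \<delta>: "\<delta> > 0"
  shows "set_integrable lborel {x. \<delta> < dist x p} (\<lambda>x. 1 / dist x p powr (real DIM('a) + s))"
proof -
  let ?q = "real DIM('a) + s" and ?D = "{x. \<delta> < dist x p}"
  let ?v = "unit_ball_vol (real DIM('a))"
  let ?h = "\<lambda>\<tau>. ennreal (if \<delta> \<le> \<tau> then ?v * \<tau> ^ DIM('a) else 0)"
  have le: "emeasure lborel (?D \<inter> cball p \<tau>) \<le> ?h \<tau>" if "\<tau> > 0" for \<tau>
  proof (cases "\<delta> \<le> \<tau>")
    case True
    then show ?thesis
      using that emeasure_mono[of "?D \<inter> cball p \<tau>" "cball p \<tau>" lborel] by (simp add: emeasure_cball)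
  next
    case False
    then have "?D \<inter> cball p \<tau> = {}" by (auto simp: dist_commute)
    with False show ?thesis by simp
  qed
  have tail: "((\<lambda>\<tau>. if \<tau> \<in> {\<delta>..} then ?q * ?v * \<tau> powr (-s-1) else 0) has_integral
      ?q * ?v * (-(\<delta> powr (-s-1+1)) / (-s-1+1))) UNIV"
    using s \<delta> by (subst has_integral_restrict_UNIV) (intro has_integral_mult_right has_integral_powr_to_inf; simp)
  have "(\<integral>\<^sup>+x. ennreal (1 / dist x p powr ?q) * indicator ?D x \<partial>lborel)
     \<le> (\<integral>\<^sup>+\<tau>. ennreal (?q * \<tau> powr (-?q-1)) * ?h \<tau> * indicator {0<..} \<tau> \<partial>lborel)"
    using s le by (intro nn_integral_inverse_dist_powr_le) auto
  also have "\<dots> = (\<integral>\<^sup>+\<tau>. ennreal (if \<tau> \<in> {\<delta>..} then ?q * ?v * \<tau> powr (-s-1) else 0) \<partial>lborel)"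
  proof (intro nn_integral_cong)
    fix \<tau>
    have "\<tau> powr (-?q-1) * \<tau> ^ DIM('a) = \<tau> powr (-s-1)" if "\<tau> \<ge> \<delta>"
      using that \<delta> by (simp add: powr_realpow[symmetric] powr_add[symmetric])
    then show "ennreal (?q * \<tau> powr (-?q-1)) * ?h \<tau> * indicator {0<..} \<tau>
      = ennreal (if \<tau> \<in> {\<delta>..} then ?q * ?v * \<tau> powr (-s-1) else 0)"
      using \<delta> s by (auto simp: indicator_def ennreal_mult[symmetric] mult_ac)
  qed
  also have "\<dots> = ennreal (?q * ?v * (-(\<delta> powr (-s-1+1)) / (-s-1+1)))"
    using s by (intro nn_integral_has_integral_lborel tail) auto
  finally show ?thesis
    by (intro set_integrable_nonnegI) (auto simp: top_unique less_top[symmetric])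
qed

text \<open>The growth exponent \<open>d\<close> beats the singularity \<open>q\<close>: near 0 the
  layer-cake integrand is of order \<open>\<tau> powr (d-q-1)\<close>, which is integrable. Beyond
  \<open>r\<close> the volume of \<open>D\<close> is exhausted and only the decaying factor
  remains.\<close>

lemma integrable_inverse_dist_powr_thin:
  fixes p :: "'a::euclidean_space"
  assumes D[measurable]: "D \<in> sets borel" and q: "0 < q" "q < d" and r: "r > 0" and C: "C \<ge> 0"
    and sub: "D \<subseteq> cball p r"
    and thin: "\<And>\<tau>. 0 < \<tau> \<Longrightarrow> \<tau> \<le> r \<Longrightarrow> emeasure lborel (D \<inter> cball p \<tau>) \<le> ennreal (C * \<tau> powr d)"
  shows "set_integrable lborel D (\<lambda>x. 1 / dist x p powr q)"
proof -
  let ?h = "\<lambda>\<tau>. ennreal (C * (if \<tau> \<le> r then \<tau> powr d else r powr d))"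
  have le: "emeasure lborel (D \<inter> cball p \<tau>) \<le> ?h \<tau>" if "\<tau> > 0" for \<tau>
  proof (cases "\<tau> \<le> r")
    case False
    then have "D \<inter> cball p \<tau> = D \<inter> cball p r" using sub by auto
    with False show ?thesis using thin[of r] r by simp
  qed (use thin that in simp)
  have 1: "((\<lambda>\<tau>. if \<tau> \<in> {0..r} then q * C * \<tau> powr (d - q - 1) else 0) has_integral
        q * C * (r powr (d - q - 1 + 1) / (d - q - 1 + 1))) UNIV"
    using q r by (subst has_integral_restrict_UNIV) (intro has_integral_mult_right has_integral_powr_from_0; simp)
  have 2: "((\<lambda>\<tau>. if \<tau> \<in> {r..} then q * C * r powr d * \<tau> powr (-q-1) else 0) has_integral
        q * C * r powr d * (-(r powr (-q-1+1)) / (-q-1+1))) UNIV"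
    using q r by (subst has_integral_restrict_UNIV) (intro has_integral_mult_right has_integral_powr_to_inf; simp)
  have "(\<integral>\<^sup>+x. ennreal (1 / dist x p powr q) * indicator D x \<partial>lborel)
     \<le> (\<integral>\<^sup>+\<tau>. ennreal (q * \<tau> powr (-q-1)) * ?h \<tau> * indicator {0<..} \<tau> \<partial>lborel)"
    using q le by (intro nn_integral_inverse_dist_powr_le) auto
  also have "\<dots> \<le> (\<integral>\<^sup>+\<tau>. ennreal (if \<tau> \<in> {0..r} then q * C * \<tau> powr (d - q - 1) else 0)
      + ennreal (if \<tau> \<in> {r..} then q * C * r powr d * \<tau> powr (-q-1) else 0) \<partial>lborel)"
  proof (intro nn_integral_mono)
    fix \<tau> :: real
    have "\<tau> powr (-q-1) * \<tau> powr d = \<tau> powr (d-q-1)" if "\<tau> > 0"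
      using that by (simp add: powr_add[symmetric] algebra_simps)
    then show "ennreal (q * \<tau> powr (-q-1)) * ?h \<tau> * indicator {0<..} \<tau>
       \<le> ennreal (if \<tau> \<in> {0..r} then q * C * \<tau> powr (d - q - 1) else 0)
      + ennreal (if \<tau> \<in> {r..} then q * C * r powr d * \<tau> powr (-q-1) else 0)"
      using q C by (auto simp: indicator_def ennreal_mult[symmetric] mult_ac intro!: add_increasing2)
  qed
  also have "\<dots> < \<infinity>"
    using q r C nn_integral_has_integral_lborel[OF _ _ 1] nn_integral_has_integral_lborel[OF _ _ 2]
    by (subst nn_integral_add) auto
  finally show ?thesis
    by (intro set_integrable_nonnegI) (auto simp: top_unique less_top[symmetric])
qed

text \<open>The ball of radius \<open>r\<close> alone contributes at least
  \<open>?v * r powr (-s)\<close>, which is unbounded as \<open>r\<close> tends to 0.\<close>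

lemma not_integrable_inverse_dist_powr:
  fixes p :: "'a::euclidean_space"
  assumes s: "s > 0"
  shows "\<not> integrable lborel (\<lambda>x. 1 / dist x p powr (real DIM('a) + s))"
proof
  let ?q = "real DIM('a) + s" and ?v = "unit_ball_vol (real DIM('a))"
  assume int: "integrable lborel (\<lambda>x. 1 / dist x p powr ?q)"
  define I where "I = (LINT x|lborel. 1 / dist x p powr ?q)"
  have lower: "?v * r powr (-s) \<le> I" if r: "r > 0" for r
  proof -
    \<comment> \<open>The centre is removed because division by zero makes the integrand 0
      there.\<close>
    have "(LINT x|lborel. indicator (ball p r - {p}) x * (1 / r powr ?q)) \<le> I"
      unfolding I_def
    proof (rule integral_mono[OF _ int])
      show "integrable lborel (\<lambda>x. indicator (ball p r - {p}) x * (1 / r powr ?q))"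
        using emeasure_mono[of "ball p r - {p}" "ball p r" lborel] emeasure_lborel_ball_finite[of p r]
        by (intro integrable_mult_left integrable_real_indicator) (auto intro: le_less_trans)
      show "indicator (ball p r - {p}) x * (1 / r powr ?q) \<le> 1 / dist x p powr ?q" for x
        using r s by (auto simp: indicator_def dist_commute intro!: divide_left_mono powr_mono2)
    qed
    moreover have "measure lborel (ball p r - {p}) = ?v * r ^ DIM('a)"
      using r emeasure_lborel_ball_finite[of p r]
      by (subst measure_Diff) (auto simp: content_ball measure_def emeasure_ball)
    moreover have "?v * r ^ DIM('a) * (1 / r powr ?q) = ?v * r powr (-s)"
      using r by (simp add: powr_realpow[symmetric] powr_diff[symmetric] divide_inverse powr_minus[symmetric] powr_add[symmetric])
    ultimately show ?thesis by simp
  qed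
  have v: "?v > 0" by (intro unit_ball_vol_pos) simp
  then have v0: "?v \<noteq> 0" by linarith
  have I: "I \<ge> 0" unfolding I_def by (intro integral_nonneg_AE) simp
  \<comment> \<open>The radius at which the lower bound equals \<open>I + 1\<close>.\<close>
  define r where "r = ((I + 1) / ?v) powr (-1/s)"
  have "r > 0" using v0 I by (simp add: r_def)
  moreover have "r powr (-s) = (I + 1) / ?v"
    using v v0 I s by (simp add: r_def powr_powr)
  ultimately have "I + 1 \<le> I" using lower[of r] v0 by simp
  then show False by simp
qed

section \<open>Nonlocal mean curvature under symmetries\<close>

lemma borel_measurable_nmc_kernel:
  fixes E :: "'a::euclidean_space set"
  assumes [measurable]: "E \<in> sets borel"
  shows "nmc_kernel s E p \<in> borel_measurable borel"
  unfolding nmc_kernel_def by measurable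

lemma set_integrable_nmc_kernel:
  fixes E :: "'a::euclidean_space set"
  assumes E: "E \<in> sets borel" and s: "s > 0" and \<delta>: "\<delta> > 0"
  shows "set_integrable lborel {x. \<delta> < dist x p} (nmc_kernel s E p)"
proof (rule set_integrable_bound[OF integrable_inverse_dist_powr_far[OF s \<delta>, of p]])
  show "set_borel_measurable lborel {x. \<delta> < dist x p} (nmc_kernel s E p)"
    using borel_measurable_nmc_kernel[OF E, measurable] unfolding set_borel_measurable_def by measurable
  show "AE x in lborel. x \<in> {x. \<delta> < dist x p} \<longrightarrow>
      norm (nmc_kernel s E p x) \<le> norm (1 / dist x p powr (real DIM('a) + s))"
    by (auto simp: nmc_kernel_def indicator_def)
qed

text \<open>An isometry fixing \<open>p\<close> preserves both the truncated domain and Lebesgue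
  measure, so averaging the kernel does not change truncated integrals. Once the average is
  absolutely integrable, dominated convergence replaces the principal value by a plain
  integral.\<close>

lemma has_nonlocal_mean_curvature_symmetrize:
  fixes E :: "'a::euclidean_space set"
  assumes E: "E \<in> sets borel" and s: "s > 0"
    and R: "orthogonal_transformation R" "R p = p"
    and int: "integrable lborel (\<lambda>x. (nmc_kernel s E p x + nmc_kernel s E p (R x)) / 2)"
  shows "has_nonlocal_mean_curvature s E p (LINT x|lborel. (nmc_kernel s E p x + nmc_kernel s E p (R x)) / 2)"
proof -
  let ?K = "nmc_kernel s E p"
  let ?g = "\<lambda>x. (?K x + ?K (R x)) / 2"
  note E[measurable] borel_measurable_nmc_kernel[OF E, measurable]
  have lin: "linear R" and norm: "\<And>x. norm (R x) = norm x"
    using R by (auto simp: orthogonal_transformation)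
  have dist: "dist (R x) p = dist x p" for x
    by (metis R(2) dist_norm lin linear_diff norm)
  have [measurable]: "R \<in> borel_measurable borel"
    by (intro borel_measurable_continuous_onI linear_continuous_on linear_conv_bounded_linear[THEN iffD1] lin)
  have trunc: "nmc_trunc s E p \<delta> = (LINT x|lborel. indicator {x. \<delta> < dist x p} x * ?g x)" if "\<delta> > 0" for \<delta>
  proof -
    let ?A = "{x. \<delta> < dist x p}"
    let ?F = "\<lambda>x. indicator ?A x * ?K x"
    have [measurable]: "?F \<in> borel_measurable borel" by measurable
    have int1: "integrable lborel ?F"
      using set_integrable_nmc_kernel[OF E s that] by (simp add: set_integrable_def)
    have int2: "integrable lborel (\<lambda>x. ?F (R x))"
      using int1 by (subst integrable_similarity[OF lin, of 1]) (auto simp: norm)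
    have "(LINT x|lborel. ?F (R x)) = (LINT x|lborel. ?F x)"
      by (subst integral_similarity[OF lin, of 1]) (auto simp: norm)
    then have "(LINT x|lborel. (?F x + ?F (R x)) / 2) = (LINT x|lborel. ?F x)"
      using int1 int2 by simp
    moreover have "(?F x + ?F (R x)) / 2 = indicator ?A x * ?g x" for x
      by (simp add: indicator_def dist)
    ultimately show ?thesis
      by (simp add: nmc_trunc_def set_lebesgue_integral_def)
  qed
  have "((\<lambda>\<delta>. LINT x|lborel. indicator {x. \<delta> < dist x p} x * ?g x) \<longlongrightarrow> (LINT x|lborel. ?g x)) (at_right 0)"
  proof (rule tendsto_at_right_sequentially[of 0 1])
    fix S :: "nat \<Rightarrow> real" assume S: "S \<longlonglongrightarrow> 0" and pos: "\<And>n. 0 < S n"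
    show "(\<lambda>n. LINT x|lborel. indicator {x. S n < dist x p} x * ?g x) \<longlonglongrightarrow> (LINT x|lborel. ?g x)"
    proof (rule integral_dominated_convergence[where w="\<lambda>x. \<bar>?g x\<bar>"])
      show "AE x in lborel. (\<lambda>n. indicator {x. S n < dist x p} x * ?g x) \<longlonglongrightarrow> ?g x"
      proof (intro AE_I2)
        fix x
        show "(\<lambda>n. indicator {x. S n < dist x p} x * ?g x) \<longlonglongrightarrow> ?g x"
        proof (cases "x = p")
          \<comment> \<open>At \<open>p\<close> both kernels are 0 by division by zero, so no
            exceptional point arises.\<close>
          case True
          then show ?thesis by (simp add: nmc_kernel_def R)
        next
          case False
          then have "eventually (\<lambda>n. S n < dist x p) sequentially"
            using order_tendstoD(2)[OF S] by simp
          then have "eventually (\<lambda>n. indicator {x. S n < dist x p} x * ?g x = ?g x) sequentially"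
            by eventually_elim simp
          then show ?thesis
            by (rule tendsto_eventually)
        qed
      qed
    qed (use int integrable_abs[OF int] in \<open>auto simp: indicator_def\<close>)
  qed simp
  then have "(nmc_trunc s E p \<longlongrightarrow> (LINT x|lborel. ?g x)) (at_right 0)"
    by (rule Lim_transform_eventually) (auto simp: trunc intro!: eventually_at_rightI[of 0 1])
  with set_integrable_nmc_kernel[OF E s] show ?thesis
    by (simp add: has_nonlocal_mean_curvature_def)
qed

text \<open>Under the substitution by \<open>T\<close> the kernel scales by
  \<open>c powr -(N+s)\<close> and the volume by \<open>c ^ N\<close>, where \<open>N\<close> is the
  dimension; this leaves \<open>c powr -s\<close>. The truncation radius \<delta> becomes
  \<open>\<delta> / c\<close>, which still tends to 0 from the right.\<close>

lemma has_nonlocal_mean_curvature_similarity: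
  fixes E :: "'a::euclidean_space set"
  assumes E: "E \<in> sets borel" and s: "s > 0"
    and T: "linear (T :: 'a \<Rightarrow> 'a)" and c: "c > 0" and norm: "\<And>x. norm (T x) = c * norm x"
    and H: "has_nonlocal_mean_curvature s (T -` E) p H"
  shows "has_nonlocal_mean_curvature s E (T p) (H / c powr s)"
proof -
  note E[measurable] borel_measurable_nmc_kernel[OF E, measurable]
  have dist: "dist (T x) (T p) = c * dist x p" for x
    by (metis T dist_norm linear_diff norm)
  have kernel: "nmc_kernel s E (T p) (T x) = nmc_kernel s (T -` E) p x / c powr (real DIM('a) + s)" for x
    using c by (simp add: nmc_kernel_def dist powr_mult indicator_vimage flip: vimage_Compl)
  have trunc: "nmc_trunc s (T -` E) p (\<delta> / c) / c powr s = nmc_trunc s E (T p) \<delta>" if "\<delta> > 0" for \<delta>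
  proof -
    have ind: "indicator {x. \<delta> < dist x (T p)} (T x) = (indicator {x. \<delta> / c < dist x p} x :: real)" for x
      using c by (simp add: indicator_def dist pos_divide_less_eq mult.commute)
    have "nmc_trunc s E (T p) \<delta> = c ^ DIM('a) * (LINT x|lborel. indicator {x. \<delta> < dist x (T p)} (T x) * nmc_kernel s E (T p) (T x))"
      unfolding nmc_trunc_def set_lebesgue_integral_def using c
      by (subst integral_similarity[OF T c norm, where F="\<lambda>x. indicator {x. \<delta> < dist x (T p)} x * nmc_kernel s E (T p) x"]) auto
    also have "(LINT x|lborel. indicator {x. \<delta> < dist x (T p)} (T x) * nmc_kernel s E (T p) (T x))
       = (LINT x|lborel. indicator {x. \<delta> / c < dist x p} x * nmc_kernel s (T -` E) p x / c powr (real DIM('a) + s))"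
      by (intro Bochner_Integration.integral_cong) (simp_all add: kernel ind)
    also have "\<dots> = nmc_trunc s (T -` E) p (\<delta> / c) / c powr (real DIM('a) + s)"
      by (simp add: nmc_trunc_def set_lebesgue_integral_def)
    finally show ?thesis
      using c by (simp add: powr_add powr_realpow)
  qed
  have lim: "filterlim (\<lambda>\<delta>. \<delta> / c) (at_right 0) (at_right 0)"
    using c by (auto intro!: tendsto_eq_intros simp: filterlim_at eventually_at_filter)
  have "(nmc_trunc s (T -` E) p \<longlongrightarrow> H) (at_right 0)"
    using H by (simp add: has_nonlocal_mean_curvature_def)
  then have "((\<lambda>\<delta>. nmc_trunc s (T -` E) p (\<delta> / c)) \<longlongrightarrow> H) (at_right 0)"
    by (rule filterlim_compose) (rule lim)
  then have "((\<lambda>\<delta>. nmc_trunc s (T -` E) p (\<delta> / c) / c powr s) \<longlongrightarrow> H / c powr s) (at_right 0)"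
    using c by (intro tendsto_divide tendsto_const) auto
  then have "(nmc_trunc s E (T p) \<longlongrightarrow> H / c powr s) (at_right 0)"
    by (rule Lim_transform_eventually) (auto simp: trunc intro!: eventually_at_rightI[of 0 1])
  with set_integrable_nmc_kernel[OF E s] show ?thesis
    by (simp add: has_nonlocal_mean_curvature_def)
qed

section \<open>The tilted cone\<close>

text \<open>Each slice over a fixed \<open>y\<close> is a sphere, hence null, and Fubini
  applies.\<close>

lemma null_sets_cone:
  fixes t :: real
  shows "{x. norm (snd x) = t * norm (fst x)} \<in> null_sets (lborel :: ('a::euclidean_space \<times> 'b::euclidean_space) measure)"
proof (rule null_setsI)
  let ?C = "{x. norm (snd x) = t * norm (fst x)} :: ('a \<times> 'b) set"
  have C: "?C \<in> sets borel"
    by (intro borel_closed closed_Collect_eq continuous_intros)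
  then show "?C \<in> sets lborel" by simp
  have "Pair y -` ?C = sphere 0 (t * norm y)" for y
    by auto
  moreover have "emeasure lborel (sphere 0 r :: 'b set) = 0" for r
  proof -
    have "sphere (0::'b) r \<in> null_sets lebesgue"
      using negligible_sphere by (simp only: negligible_iff_null_sets)
    then have "sphere (0::'b) r \<in> null_sets lborel"
      by (subst (asm) null_sets_completion_iff) auto
    then show ?thesis by (rule null_setsD1)
  qed
  moreover have "emeasure (lborel \<Otimes>\<^sub>M lborel) ?C = (\<integral>\<^sup>+y. emeasure lborel (Pair y -` ?C) \<partial>lborel)"
    by (intro lborel.emeasure_pair_measure_alt) (subst lborel_prod, simp add: C)
  ultimately show "emeasure lborel ?C = 0"
    by (simp add: lborel_prod)
qed

text \<open>The quadratic form of the cone is divided by \<open>t\<close>: this frees the cross term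
  of \<open>t\<close> and leaves the other terms decreasing in \<open>t\<close>.\<close>

definition tilted_form :: "'a::euclidean_space \<Rightarrow> 'b::euclidean_space \<Rightarrow> real \<Rightarrow> 'a \<times> 'b \<Rightarrow> real" where
  "tilted_form e f t x = 2 * (fst x \<bullet> e) * (snd x \<bullet> f) + (norm (snd x))\<^sup>2 / t
     - t * ((norm (fst x))\<^sup>2 - (fst x \<bullet> e)\<^sup>2 + (snd x \<bullet> f)\<^sup>2)"

lemma borel_measurable_tilted_form [measurable]: "tilted_form e f t \<in> borel_measurable borel"
  unfolding tilted_form_def divide_inverse
  by (intro borel_measurable_continuous_onI continuous_intros)

text \<open>
  The isometry that maps the ray through \<open>(e, 0)\<close> to a ray in the boundary of the cone with slope \<open>t\<close>;
  it pulls the form \<open>|z|\<^sup>2 - t\<^sup>2|y|\<^sup>2\<close> back to \<open>t * tilted_form\<close>.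
\<close>
definition tilt :: "'a::euclidean_space \<Rightarrow> 'b::euclidean_space \<Rightarrow> real \<Rightarrow> 'a \<times> 'b \<Rightarrow> 'a \<times> 'b" where
  "tilt e f t x =
    (fst x + ((fst x \<bullet> e - t * (snd x \<bullet> f)) / sqrt (1 + t\<^sup>2) - fst x \<bullet> e) *\<^sub>R e,
     snd x + ((t * (fst x \<bullet> e) + snd x \<bullet> f) / sqrt (1 + t\<^sup>2) - snd x \<bullet> f) *\<^sub>R f)"

lemma linear_tilt: "linear (tilt e f t)"
proof -
  define k l where "k x = (fst x \<bullet> e - t * (snd x \<bullet> f)) / sqrt (1 + t\<^sup>2) - fst x \<bullet> e"
    and "l x = (t * (fst x \<bullet> e) + snd x \<bullet> f) / sqrt (1 + t\<^sup>2) - snd x \<bullet> f" for x :: "'a \<times> 'b"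
  have add: "k (x + y) = k x + k y" "l (x + y) = l x + l y" for x y
    by (simp_all add: k_def l_def inner_add_left distrib_left add_divide_distrib diff_divide_distrib)
  have scale: "k (r *\<^sub>R x) = r * k x" "l (r *\<^sub>R x) = r * l x" for r x
    by (simp_all add: k_def l_def right_diff_distrib distrib_left add_divide_distrib diff_divide_distrib)
  have "tilt e f t = (\<lambda>x. (fst x + k x *\<^sub>R e, snd x + l x *\<^sub>R f))"
    by (simp add: tilt_def k_def l_def fun_eq_iff)
  then show ?thesis
    by (intro linearI) (simp_all add: add scale scaleR_add_left scaleR_add_right del: fst_add snd_add,
      simp_all add: scaleR_add_right)
qed

lemma inner_unit_sq_le:
  fixes y e :: "'a::real_inner"
  assumes "norm e = 1"
  shows "(y \<bullet> e)\<^sup>2 \<le> (norm y)\<^sup>2"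
  using Cauchy_Schwarz_ineq2[of y e] assms abs_le_square_iff[of "y \<bullet> e" "norm y"] by simp

text \<open>Pythagoras: the component of \<open>y\<close> along \<open>e\<close> is replaced by
  \<open>a\<close>. Both \<open>tilt\<close> and \<open>flip\<close> act in this way.\<close>

lemma norm_add_scaleR_unit_sq:
  fixes y e :: "'a::real_inner"
  assumes "norm e = 1"
  shows "(norm (y + (a - y \<bullet> e) *\<^sub>R e))\<^sup>2 = (norm y)\<^sup>2 - (y \<bullet> e)\<^sup>2 + a\<^sup>2"
proof -
  have "e \<bullet> e = 1" using assms by (simp add: dot_square_norm)
  then show ?thesis
    unfolding power2_norm_eq_inner
    by (simp add: inner_add_left inner_add_right inner_commute power2_eq_square algebra_simps)
qed

lemma
  assumes e: "norm e = 1" and f: "norm f = 1"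
  shows norm_tilt: "norm (tilt e f t x) = norm x"
    and tilted_form_eq: "t > 0 \<Longrightarrow> (norm (snd (tilt e f t x)))\<^sup>2 - t\<^sup>2 * (norm (fst (tilt e f t x)))\<^sup>2 = t * tilted_form e f t x"
proof -
  \<comment> \<open>Only the coordinates \<open>u\<close> and \<open>v\<close> move, by a rotation
    with cosine \<open>1 / w\<close> and sine \<open>t / w\<close>; both claims reduce to identities
    in this plane.\<close>
  define u v w where "u = fst x \<bullet> e" and "v = snd x \<bullet> f" and "w = sqrt (1 + t\<^sup>2)"
  have w: "w\<^sup>2 = 1 + t\<^sup>2" "w > 0" by (auto simp: w_def add_pos_nonneg)
  have nz: "1 + t\<^sup>2 \<noteq> 0" by (simp add: add_nonneg_eq_0_iff)
  have 1: "(norm (fst (tilt e f t x)))\<^sup>2 = (norm (fst x))\<^sup>2 - u\<^sup>2 + ((u - t * v) / w)\<^sup>2"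
    and 2: "(norm (snd (tilt e f t x)))\<^sup>2 = (norm (snd x))\<^sup>2 - v\<^sup>2 + ((t * u + v) / w)\<^sup>2"
    using norm_add_scaleR_unit_sq[OF e, of "fst x"] norm_add_scaleR_unit_sq[OF f, of "snd x"]
    by (auto simp: tilt_def u_def v_def w_def)
  have "((u - t * v) / w)\<^sup>2 + ((t * u + v) / w)\<^sup>2 = (u\<^sup>2 + v\<^sup>2) * (1 + t\<^sup>2) / w\<^sup>2"
    by (simp add: power_divide add_divide_distrib[symmetric] power2_eq_square algebra_simps)
  then have "((u - t * v) / w)\<^sup>2 + ((t * u + v) / w)\<^sup>2 = u\<^sup>2 + v\<^sup>2"
    using w nz by simp
  with 1 2 have "(norm (fst (tilt e f t x)))\<^sup>2 + (norm (snd (tilt e f t x)))\<^sup>2 = (norm (fst x))\<^sup>2 + (norm (snd x))\<^sup>2"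
    by simp
  then show "norm (tilt e f t x) = norm x"
    by (simp add: norm_prod_def)
  assume t: "t > 0"
  have "((t * u + v) / w)\<^sup>2 - t\<^sup>2 * ((u - t * v) / w)\<^sup>2 = (2 * t * u * v + v\<^sup>2 - t\<^sup>2 * v\<^sup>2) * (1 + t\<^sup>2) / w\<^sup>2"
    by (simp add: power_divide diff_divide_distrib[symmetric] power2_eq_square algebra_simps)
  then have "((t * u + v) / w)\<^sup>2 - t\<^sup>2 * ((u - t * v) / w)\<^sup>2 = 2 * t * u * v + v\<^sup>2 - t\<^sup>2 * v\<^sup>2"
    using w nz by simp
  then show "(norm (snd (tilt e f t x)))\<^sup>2 - t\<^sup>2 * (norm (fst (tilt e f t x)))\<^sup>2 = t * tilted_form e f t x"
    unfolding 1 2 using t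
    by (simp add: tilted_form_def u_def[symmetric] v_def[symmetric] power2_eq_square algebra_simps)
qed

lemma tilted_form_pos_iff:
  assumes "norm e = 1" "norm f = 1" "t > 0"
  shows "tilted_form e f t x > 0 \<longleftrightarrow> norm (snd (tilt e f t x)) > t * norm (fst (tilt e f t x))"
proof -
  have "tilted_form e f t x > 0 \<longleftrightarrow> t * tilted_form e f t x > 0"
    using assms by (simp add: zero_less_mult_iff)
  also have "\<dots> \<longleftrightarrow> (t * norm (fst (tilt e f t x)))\<^sup>2 < (norm (snd (tilt e f t x)))\<^sup>2"
    unfolding tilted_form_eq[OF assms, symmetric] by (simp add: power_mult_distrib)
  also have "\<dots> \<longleftrightarrow> norm (snd (tilt e f t x)) > t * norm (fst (tilt e f t x))"
    using assms by (simp add: power_mono_iff flip: not_le)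
  finally show ?thesis .
qed

text \<open>The zero set is the preimage of the null cone under the isometry
  \<open>tilt\<close>.\<close>

lemma null_sets_tilted_form_zero:
  fixes e :: "'a::euclidean_space" and f :: "'b::euclidean_space"
  assumes "norm e = 1" "norm f = 1" "t > 0"
  shows "{x. tilted_form e f t x = 0} \<in> null_sets lborel"
proof (rule null_setsI)
  let ?C = "{x :: 'a \<times> 'b. norm (snd x) = t * norm (fst x)}"
  have "tilted_form e f t x = 0 \<longleftrightarrow> x \<in> tilt e f t -` ?C" for x
  proof -
    have "tilted_form e f t x = 0 \<longleftrightarrow> t * tilted_form e f t x = 0"
      using assms by simp
    also have "\<dots> \<longleftrightarrow> (norm (snd (tilt e f t x)))\<^sup>2 = (t * norm (fst (tilt e f t x)))\<^sup>2"
      unfolding tilted_form_eq[OF assms, symmetric] by (simp add: power_mult_distrib)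
    also have "\<dots> \<longleftrightarrow> norm (snd (tilt e f t x)) = t * norm (fst (tilt e f t x))"
      using assms by (intro power2_eq_iff_nonneg) auto
    finally show ?thesis by simp
  qed
  then have eq: "{x. tilted_form e f t x = 0} = tilt e f t -` ?C" by blast
  have "?C \<in> null_sets lborel" by (rule null_sets_cone)
  moreover from this have "?C \<in> sets borel" by (simp add: null_sets_def)
  ultimately have "emeasure lborel (tilt e f t -` ?C) = ennreal (1 / 1 ^ DIM('a \<times> 'b)) * emeasure lborel ?C"
    by (intro emeasure_similarity_vimage[OF linear_tilt]) (simp_all only: norm_tilt assms(1,2) mult_1 zero_less_one)
  also have "emeasure lborel ?C = 0" by (intro null_setsD1 null_sets_cone)
  finally show "emeasure lborel {x. tilted_form e f t x = 0} = 0"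
    unfolding eq by (simp only: mult_zero_right)
  show "{x. tilted_form e f t x = 0} \<in> sets lborel"
    by simp
qed

lemma tilted_form_antimono:
  assumes "norm e = 1" "0 < t" "t \<le> t'"
  shows "tilted_form e f t' x \<le> tilted_form e f t x"
proof -
  have "(fst x \<bullet> e)\<^sup>2 \<le> (norm (fst x))\<^sup>2"
    by (rule inner_unit_sq_le[OF assms(1)])
  then have "t * ((norm (fst x))\<^sup>2 - (fst x \<bullet> e)\<^sup>2 + (snd x \<bullet> f)\<^sup>2) \<le> t' * ((norm (fst x))\<^sup>2 - (fst x \<bullet> e)\<^sup>2 + (snd x \<bullet> f)\<^sup>2)"
    by (intro mult_right_mono[OF assms(3)]) simp
  moreover have "(norm (snd x))\<^sup>2 / t' \<le> (norm (snd x))\<^sup>2 / t"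
    using assms(2,3) by (intro divide_left_mono[OF assms(3)]) simp_all
  ultimately show ?thesis by (simp add: tilted_form_def)
qed

section \<open>The symmetrized kernel\<close>

definition tilted_set :: "'a::euclidean_space \<Rightarrow> 'b::euclidean_space \<Rightarrow> real \<Rightarrow> ('a \<times> 'b) set" where
  "tilted_set e f t = {x. tilted_form e f t x > 0}"

text \<open>The reflection \<open>v \<mapsto> -v\<close>; it fixes the point \<open>(e, 0)\<close>
  at which the curvature is taken.\<close>

definition flip :: "'b::euclidean_space \<Rightarrow> 'a::euclidean_space \<times> 'b \<Rightarrow> 'a \<times> 'b" where
  "flip f x = (fst x, snd x - (2 * (snd x \<bullet> f)) *\<^sub>R f)"

definition sym_kernel :: "real \<Rightarrow> 'a::euclidean_space \<Rightarrow> 'b::euclidean_space \<Rightarrow> real \<Rightarrow> 'a \<times> 'b \<Rightarrow> real" where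
  "sym_kernel s e f t x = (nmc_kernel s (tilted_set e f t) (e, 0) x + nmc_kernel s (tilted_set e f t) (e, 0) (flip f x)) / 2"

definition tilted_curvature :: "real \<Rightarrow> 'a::euclidean_space \<Rightarrow> 'b::euclidean_space \<Rightarrow> real \<Rightarrow> real" where
  "tilted_curvature s e f t = (LINT x|lborel. sym_kernel s e f t x)"

lemma tilted_set_borel [measurable]: "tilted_set e f t \<in> sets borel"
  unfolding tilted_set_def by measurable

lemma flip_borel [measurable]: "flip f \<in> borel_measurable borel"
  unfolding flip_def by (intro borel_measurable_continuous_onI continuous_intros)

lemma sym_kernel_borel [measurable]: "sym_kernel s e f t \<in> borel_measurable borel"
proof -
  have [measurable]: "nmc_kernel s (tilted_set e f t) (e, 0) \<in> borel_measurable borel"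
    by (rule borel_measurable_nmc_kernel) simp
  show ?thesis
    unfolding sym_kernel_def by measurable
qed

lemma linear_flip: "linear (flip f)"
  by (rule linearI) (simp_all add: flip_def inner_add_left scaleR_add_left algebra_simps)

lemma norm_snd_flip:
  assumes "norm f = 1"
  shows "norm (snd (flip f x)) = norm (snd x)"
proof -
  have "flip f x = (fst x, snd x + (- (snd x \<bullet> f) - snd x \<bullet> f) *\<^sub>R f)"
    by (simp add: flip_def)
  then have "(norm (snd (flip f x)))\<^sup>2 = (norm (snd x))\<^sup>2"
    using norm_add_scaleR_unit_sq[OF assms, of "snd x" "- (snd x \<bullet> f)"] by simp
  then show ?thesis by simp
qed

lemma norm_flip: "norm f = 1 \<Longrightarrow> norm (flip f x) = norm x"
  by (simp add: norm_prod_def norm_snd_flip) (simp add: flip_def)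

lemma snd_flip_inner: "norm f = 1 \<Longrightarrow> snd (flip f x) \<bullet> f = - (snd x \<bullet> f)"
  by (simp add: flip_def inner_diff_left dot_square_norm)

lemma tilted_form_flip:
  assumes "norm f = 1"
  shows "tilted_form e f t (flip f x) = tilted_form e f t x - 4 * (fst x \<bullet> e) * (snd x \<bullet> f)"
  by (simp add: tilted_form_def norm_snd_flip snd_flip_inner assms) (simp add: flip_def)

lemma dist_flip: "norm f = 1 \<Longrightarrow> dist (flip f x) (e, 0) = dist x (e, 0)"
proof -
  assume f: "norm f = 1"
  have "flip f x - (e, 0) = flip f (x - (e, 0))"
    by (simp add: linear_diff[OF linear_flip]) (simp add: flip_def)
  then show ?thesis by (simp add: dist_norm norm_flip[OF f])
qed

lemma nmc_kernel_eq_sign: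
  "nmc_kernel s E p x = (if x \<in> E then 1 else -1) / dist x p powr (real DIM('a) + s)"
  for p :: "'a::euclidean_space"
  by (simp add: nmc_kernel_def)

text \<open>The averaged sign is 1, 0 or -1, and it is 0 exactly when only one of \<open>x\<close>
  and its mirror image lies in the set. This cancellation tames the singularity.\<close>

lemma sym_kernel_eq:
  fixes e :: "'a::euclidean_space" and f :: "'b::euclidean_space"
  assumes "norm f = 1"
  shows "sym_kernel s e f t x =
    ((if tilted_form e f t x > 0 then 1 else -1) + (if tilted_form e f t (flip f x) > 0 then 1 else -1)) / 2
      * (1 / dist x (e, 0) powr (real DIM('a \<times> 'b) + s))"
  by (simp add: sym_kernel_def nmc_kernel_eq_sign dist_flip[OF assms] tilted_set_def)

lemma abs_sym_kernel_le:
  fixes e :: "'a::euclidean_space" and f :: "'b::euclidean_space"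
  assumes "norm f = 1"
  shows "\<bar>sym_kernel s e f t x\<bar> \<le> 1 / dist x (e, 0) powr (real DIM('a \<times> 'b) + s)"
  unfolding sym_kernel_eq[OF assms] by (simp add: abs_mult)

lemma sym_kernel_antimono:
  fixes e :: "'a::euclidean_space" and f :: "'b::euclidean_space"
  assumes "norm e = 1" "norm f = 1" "0 < t" "t \<le> t'"
  shows "sym_kernel s e f t' x \<le> sym_kernel s e f t x"
  unfolding sym_kernel_eq[OF assms(2)]
  using tilted_form_antimono[OF assms(1,3,4), of f x] tilted_form_antimono[OF assms(1,3,4), of f "flip f x"]
  by (intro mult_right_mono) (auto simp del: norm_eq_zero)

text \<open>The form takes the values \<open>B + 2uv\<close> at \<open>x\<close> and
  \<open>B - 2uv\<close> at its mirror image, where \<open>B\<close> is even in \<open>v\<close>.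
  Without cancellation both lie on the same side of 0, which forces \<open>|2uv| \<le> |B|\<close>;
  and \<open>B\<close> is of second order in the distance to \<open>(e, 0)\<close>.\<close>

lemma sym_kernel_thin:
  fixes e :: "'a::euclidean_space" and f :: "'b::euclidean_space"
  assumes e: "norm e = 1" and f: "norm f = 1" and t: "0 < t"
    and x: "dist x (e, 0) \<le> 1/2" and nz: "sym_kernel s e f t x \<noteq> 0"
  shows "\<bar>snd x \<bullet> f\<bar> \<le> (t + 1/t) * (dist x (e, 0))\<^sup>2"
proof -
  define u v r where "u = fst x \<bullet> e" and "v = snd x \<bullet> f" and "r = dist x (e, 0)"
  define B where "B = (norm (snd x))\<^sup>2 / t - t * ((norm (fst x))\<^sup>2 - u\<^sup>2 + v\<^sup>2)"
  have ee: "e \<bullet> e = 1" using e by (simp add: dot_square_norm)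
  have r2: "r\<^sup>2 = (norm (fst x - e))\<^sup>2 + (norm (snd x))\<^sup>2"
    by (simp add: r_def dist_norm norm_prod_def)
  have y: "(norm (fst x - e))\<^sup>2 = (norm (fst x))\<^sup>2 - u\<^sup>2 + (u - 1)\<^sup>2"
    unfolding power2_norm_eq_inner
    by (simp add: u_def ee inner_diff_left inner_diff_right inner_commute power2_eq_square algebra_simps)
  have uy: "u\<^sup>2 \<le> (norm (fst x))\<^sup>2" and vz: "v\<^sup>2 \<le> (norm (snd x))\<^sup>2"
    unfolding u_def v_def by (rule inner_unit_sq_le[OF e], rule inner_unit_sq_le[OF f])
  have "\<bar>u - 1\<bar> \<le> r"
  proof -
    have "(u - 1)\<^sup>2 \<le> r\<^sup>2"
      using r2 y uy zero_le_power2[of "norm (snd x)"] by linarith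
    then show ?thesis
      by (simp add: r_def flip: abs_le_square_iff)
  qed
  \<comment> \<open>This is the reason for the radius \<open>1/2\<close>: it gives
    \<open>2 * u \<ge> 1\<close>, so \<open>|v|\<close> is at most \<open>|2uv|\<close>.\<close>
  then have u: "u \<ge> 1/2" using x by (simp add: r_def)
  have "tilted_form e f t x = 2 * u * v + B" "tilted_form e f t (flip f x) = B - 2 * u * v"
    by (simp_all add: tilted_form_flip[OF f]) (simp_all add: tilted_form_def u_def v_def B_def)
  then have "\<bar>2 * u * v\<bar> \<le> \<bar>B\<bar>"
    using nz by (auto simp: sym_kernel_eq[OF f] split: if_splits)
  moreover have "\<bar>v\<bar> \<le> \<bar>2 * u * v\<bar>"
    using u mult_right_mono[of 1 "2 * u" "\<bar>v\<bar>"] by (simp add: abs_mult)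
  moreover have "\<bar>B\<bar> \<le> (t + 1/t) * r\<^sup>2"
  proof -
    \<comment> \<open>\<open>B\<close> is a difference of two nonnegative terms, each bounded
      separately by a multiple of \<open>r\<^sup>2\<close>.\<close>
    have "0 \<le> t * ((norm (fst x))\<^sup>2 - u\<^sup>2 + v\<^sup>2)" "t * ((norm (fst x))\<^sup>2 - u\<^sup>2 + v\<^sup>2) \<le> t * r\<^sup>2"
      using t uy vz r2 y zero_le_power2[of "u - 1"]
      by (intro mult_nonneg_nonneg mult_left_mono; simp add: add_increasing2; linarith)+
    moreover have "0 \<le> (norm (snd x))\<^sup>2 / t" "(norm (snd x))\<^sup>2 / t \<le> r\<^sup>2 / t"
      using t r2 by (auto intro!: divide_right_mono)
    moreover have "(t + 1/t) * r\<^sup>2 = t * r\<^sup>2 + r\<^sup>2 / t" by (simp add: distrib_right)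
    ultimately show ?thesis unfolding B_def by linarith
  qed
  ultimately show ?thesis by (simp add: v_def r_def)
qed

text \<open>The set fits into a box of half-width \<open>C * \<tau>\<^sup>2\<close> along
  \<open>b\<close> and \<tau> along every other axis; the flat direction gains one power of
  \<tau>.\<close>

lemma emeasure_slab_le:
  fixes p b :: "'c::euclidean_space"
  assumes b: "b \<in> Basis" and C: "C \<ge> 0" and \<tau>: "\<tau> > 0"
    and D: "\<And>x. x \<in> D \<Longrightarrow> \<bar>(x - p) \<bullet> b\<bar> \<le> C * (dist x p)\<^sup>2"
  shows "emeasure lborel (D \<inter> cball p \<tau>) \<le> ennreal (2 ^ DIM('c) * C * \<tau> powr (real DIM('c) + 1))"
proof -
  define h where "h i = (if i = b then C * \<tau>\<^sup>2 else \<tau>)" for i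
  define w where "w = (\<Sum>i\<in>Basis. h i *\<^sub>R i)"
  have w: "w \<bullet> i = h i" if "i \<in> Basis" for i
    using that by (simp add: w_def inner_sum_left_Basis)
  have h: "h i \<ge> 0" for i using C \<tau> by (simp add: h_def)
  have "D \<inter> cball p \<tau> \<subseteq> cbox (p - w) (p + w)"
  proof
    fix x assume x: "x \<in> D \<inter> cball p \<tau>"
    have "\<bar>(x - p) \<bullet> i\<bar> \<le> h i" if i: "i \<in> Basis" for i
    proof (cases "i = b")
      case True
      have "C * (dist x p)\<^sup>2 \<le> C * \<tau>\<^sup>2"
        using x C by (intro mult_left_mono power_mono) (auto simp: dist_commute)
      with True D[of x] x show ?thesis by (simp add: h_def)
    next
      case False
      with Basis_le_norm[OF i, of "x - p"] x show ?thesis by (simp add: h_def dist_norm norm_minus_commute)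
    qed
    then show "x \<in> cbox (p - w) (p + w)"
      by (auto simp: mem_box inner_diff_left inner_add_left w abs_le_iff algebra_simps)
  qed
  then have "emeasure lborel (D \<inter> cball p \<tau>) \<le> emeasure lborel (cbox (p - w) (p + w))"
    by (intro emeasure_mono) auto
  also have "\<dots> = ennreal (\<Prod>i\<in>Basis. 2 * h i)"
    using h by (subst emeasure_lborel_cbox) (auto simp: inner_diff_left inner_add_left w intro!: prod.cong)
  also have "(\<Prod>i\<in>Basis. 2 * h i) = (2 * (C * \<tau>\<^sup>2)) * (2 * \<tau>) ^ (DIM('c) - 1)"
    using b by (subst prod.remove[OF finite_Basis b]) (simp add: h_def card_Diff_singleton)
  also have "\<dots> = 2 ^ DIM('c) * C * \<tau> powr (real DIM('c) + 1)"
  proof -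
    obtain n where n: "DIM('c) = Suc n" using DIM_positive[where 'a='c] by (metis Suc_pred)
    have "\<tau> powr (real (Suc n) + 1) = \<tau> ^ (n + 2)"
      using \<tau> by (subst powr_realpow[symmetric]) auto
    then show ?thesis
      by (simp add: n power_mult_distrib power_add power2_eq_square)
  qed
  finally show ?thesis .
qed

text \<open>Near \<open>(e, 0)\<close> the kernel lives on a slab whose volume grows with exponent
  \<open>N + 1\<close>, where \<open>N\<close> is the dimension, and \<open>N + s < N + 1\<close> is
  exactly \<open>s < 1\<close>. Away from the point the decay of the full kernel suffices.\<close>

lemma integrable_sym_kernel:
  fixes e :: "'a::euclidean_space" and f :: "'b::euclidean_space"
  assumes e: "e \<in> Basis" and f: "f \<in> Basis" and t: "0 < t" and s: "0 < s" "s < 1"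
  shows "integrable lborel (sym_kernel s e f t)"
proof -
  let ?p = "(e, 0) :: 'a \<times> 'b" and ?C = "t + 1/t" and ?q = "real DIM('a \<times> 'b) + s"
  let ?D = "{x :: 'a \<times> 'b. dist x ?p \<le> 1/2 \<and> \<bar>(x - ?p) \<bullet> (0, f)\<bar> \<le> ?C * (dist x ?p)\<^sup>2}"
  have n: "norm e = 1" "norm f = 1" using e f by auto
  have C: "?C \<ge> 0" using t by simp
  have D: "?D \<in> sets borel"
    by (intro borel_closed closed_Collect_conj closed_Collect_le continuous_intros)
  have near: "set_integrable lborel ?D (\<lambda>x. 1 / dist x ?p powr ?q)"
  proof (rule integrable_inverse_dist_powr_thin[where d = "real DIM('a \<times> 'b) + 1" and r = "1/2" and C = "2 ^ DIM('a \<times> 'b) * ?C"])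
    fix \<tau> :: real assume "0 < \<tau>"
    then show "emeasure lborel (?D \<inter> cball ?p \<tau>) \<le> ennreal (2 ^ DIM('a \<times> 'b) * ?C * \<tau> powr (real DIM('a \<times> 'b) + 1))"
      using f C by (intro emeasure_slab_le[where b="(0, f)"]) (auto simp: Basis_prod_def)
  qed (use D s C in \<open>auto simp: dist_commute add_pos_nonneg\<close>)
  have far: "set_integrable lborel {x. 1/2 < dist x ?p} (\<lambda>x. 1 / dist x ?p powr ?q)"
    using s by (intro integrable_inverse_dist_powr_far) auto
  have disj: "?D \<inter> {x. 1/2 < dist x ?p} = {}" by auto
  have "integrable lborel (\<lambda>x. indicator ?D x * (1 / dist x ?p powr ?q) + indicator {x. 1/2 < dist x ?p} x * (1 / dist x ?p powr ?q))"
    using near far unfolding set_integrable_def real_scaleR_def by (rule Bochner_Integration.integrable_add)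
  then show ?thesis
  proof (rule Bochner_Integration.integrable_bound)
    show "AE x in lborel. norm (sym_kernel s e f t x) \<le> norm (indicator ?D x * (1 / dist x ?p powr ?q) + indicator {x. 1/2 < dist x ?p} x * (1 / dist x ?p powr ?q))"
    proof (intro AE_I2)
      fix x
      show "norm (sym_kernel s e f t x) \<le> norm (indicator ?D x * (1 / dist x ?p powr ?q) + indicator {x. 1/2 < dist x ?p} x * (1 / dist x ?p powr ?q))"
      proof (cases "x \<in> ?D \<or> 1/2 < dist x ?p")
        case True
        with disj have "indicator ?D x * (1 / dist x ?p powr ?q) + indicator {x. 1/2 < dist x ?p} x * (1 / dist x ?p powr ?q) = 1 / dist x ?p powr ?q"
          by (auto simp: indicator_def)
        then show ?thesis
          using abs_sym_kernel_le[OF n(2), of s e t x] by simp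
      next
        case False
        then have "dist x ?p \<le> 1/2" "\<not> \<bar>snd x \<bullet> f\<bar> \<le> ?C * (dist x ?p)\<^sup>2"
          by (auto simp: inner_prod_def)
        then have "sym_kernel s e f t x = 0"
          using sym_kernel_thin[OF n t, of x s] by blast
        then show ?thesis by simp
      qed
    qed
  qed simp
qed

section \<open>Dependence on the slope\<close>

text \<open>Equal integrals would force \<open>g = h\<close> almost everywhere, making the nonempty
  open set \<open>U\<close> null.\<close>

lemma integral_strict_mono_on_open:
  fixes g h :: "'a::euclidean_space \<Rightarrow> real"
  assumes g: "integrable lborel g" and h: "integrable lborel h" and le: "\<And>x. g x \<le> h x"
    and U: "open U" "U \<noteq> {}" and less: "\<And>x. x \<in> U \<Longrightarrow> g x < h x"
  shows "integral\<^sup>L lborel g < integral\<^sup>L lborel h"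
proof (rule ccontr)
  assume "\<not> ?thesis"
  moreover have "integral\<^sup>L lborel g \<le> integral\<^sup>L lborel h"
    by (rule integral_mono[OF g h le])
  ultimately have "(LINT x|lborel. h x - g x) = 0"
    using g h by simp
  then have "AE x in lborel. h x - g x = 0"
    using g h le by (subst (asm) integral_nonneg_eq_0_iff_AE) auto
  then have "AE x in lborel. x \<notin> U"
    by eventually_elim (use less in force)
  then have "U \<in> null_sets lborel"
    using U(1) by (subst (asm) AE_iff_null_sets[symmetric]) auto
  then have "negligible U"
    by (simp add: negligible_iff_null_sets null_sets_completionI)
  with U show False
    using open_not_negligible by blast
qed

lemma tilted_curvature_strict_antimono:
  fixes e :: "'a::euclidean_space" and f :: "'b::euclidean_space"
  assumes e: "e \<in> Basis" and f: "f \<in> Basis" and s: "0 < s" "s < 1" and t: "0 < t" "t < t'"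
  shows "tilted_curvature s e f t' < tilted_curvature s e f t"
  unfolding tilted_curvature_def
proof (rule integral_strict_mono_on_open)
  have n: "norm e = 1" "norm f = 1" using e f by auto
  \<comment> \<open>Points of \<open>?U\<close> leave the set as the slope grows from
    \<open>t\<close> to \<open>t'\<close>. The point \<open>(e, 0)\<close> is excluded because the
    kernel vanishes there by division by zero.\<close>
  let ?U = "{x. tilted_form e f t x > 0 \<and> tilted_form e f t' x < 0 \<and> x \<noteq> (e, 0)}"
  show "integrable lborel (sym_kernel s e f t')" "integrable lborel (sym_kernel s e f t)"
    using assms by (auto intro!: integrable_sym_kernel)
  show "sym_kernel s e f t' x \<le> sym_kernel s e f t x" for x
    using n t by (intro sym_kernel_antimono) auto
  show "open ?U"
    unfolding tilted_form_def divide_inverse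
    by (intro open_Collect_conj open_Collect_less open_Collect_neq continuous_intros)
  show "?U \<noteq> {}"
  proof -
    define r where "r = (t + t') / 2"
    \<comment> \<open>For \<open>x = (a e, f)\<close> the form at slope \<tau> is
      \<open>2 * a + 1 / \<tau> - \<tau>\<close>. This \<open>a\<close> makes it vanish at \<tau> =
      \<open>r\<close>, so it changes sign strictly between \<open>t\<close> and
      \<open>t'\<close>.\<close>
    define x where "x = (((r - 1 / r) / 2) *\<^sub>R e, f)"
    have r: "t < r" "r < t'" using t by (auto simp: r_def)
    have form: "tilted_form e f \<tau> x = (r - 1 / r) + 1 / \<tau> - \<tau>" for \<tau>
      using n by (simp add: tilted_form_def x_def dot_square_norm power2_eq_square)
    have "1 / r < 1 / t" "1 / t' < 1 / r"
      using r t by (auto intro!: divide_strict_left_mono mult_pos_pos)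
    then have "tilted_form e f t x > 0" "tilted_form e f t' x < 0"
      unfolding form using r by auto
    moreover have "x \<noteq> (e, 0)" using n by (auto simp: x_def)
    ultimately show ?thesis by blast
  qed
  show "sym_kernel s e f t' x < sym_kernel s e f t x" if x: "x \<in> ?U" for x
  proof -
    have "dist x (e, 0) powr (real DIM('a \<times> 'b) + s) > 0"
      using x by simp
    moreover have "tilted_form e f t' (flip f x) \<le> tilted_form e f t (flip f x)"
      using n t by (intro tilted_form_antimono) auto
    ultimately show ?thesis
      unfolding sym_kernel_eq[OF n(2)] using x
      by (intro mult_strict_right_mono) auto
  qed
qed

section \<open>Continuity of the curvature in the slope\<close>

lemma AE_tilted_form_nonzero:
  fixes e :: "'a::euclidean_space" and f :: "'b::euclidean_space"
  assumes n: "norm e = 1" "norm f = 1" and t: "t > 0"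
  shows "AE x in lborel. tilted_form e f t x \<noteq> 0 \<and> tilted_form e f t (flip f x) \<noteq> 0"
proof -
  let ?Z = "{x. tilted_form e f t x = 0}"
  have Z: "?Z \<in> null_sets lborel" by (rule null_sets_tilted_form_zero[OF n t])
  have 1: "AE x in lborel. x \<notin> ?Z" by (rule AE_not_in[OF Z])
  have "emeasure lborel (flip f -` ?Z) = ennreal (1 / 1 ^ DIM('a \<times> 'b)) * emeasure lborel ?Z"
    by (intro emeasure_similarity_vimage[OF linear_flip]) (simp_all add: norm_flip[OF n(2)])
  then have "emeasure lborel (flip f -` ?Z) = 0"
    using null_setsD1[OF Z] by (simp only: mult_zero_right)
  moreover have "flip f -` ?Z \<in> sets borel"
    by (intro measurable_sets_borel[OF flip_borel]) simp
  ultimately have "flip f -` ?Z \<in> null_sets lborel"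
    by (intro null_setsI) simp_all
  then have "AE x in lborel. x \<notin> flip f -` ?Z" by (rule AE_not_in)
  with 1 show ?thesis by eventually_elim simp
qed

lemma tilted_curvature_continuous:
  fixes e :: "'a::euclidean_space" and f :: "'b::euclidean_space"
  assumes e: "e \<in> Basis" and f: "f \<in> Basis" and s: "0 < s" "s < 1" and l: "0 < l"
  shows "continuous_on {l..r} (tilted_curvature s e f)"
proof (rule continuous_on_sequentiallyI)
  fix u a assume u: "\<forall>n. u n \<in> {l..r}" and a: "a \<in> {l..r}" and lim: "u \<longlonglongrightarrow> a"
  have n: "norm e = 1" "norm f = 1" using e f by auto
  have r: "0 < r" "0 < a" using a l by auto
  have up: "0 < u n" for n using u l by (metis atLeastAtMost_iff less_le_trans)
  \<comment> \<open>By monotonicity every kernel with slope in \<open>[l, r]\<close> lies between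
    those at the endpoints, so this is an integrable majorant.\<close>
  let ?w = "\<lambda>x. \<bar>sym_kernel s e f l x\<bar> + \<bar>sym_kernel s e f r x\<bar>"
  \<comment> \<open>Where the limiting form is nonzero the sign is eventually constant, so the
    kernels even become equal to their limit; the remaining points form a null set.\<close>
  have sgn: "eventually (\<lambda>n. (tilted_form e f (u n) x > 0) = (tilted_form e f a x > 0)) sequentially"
    if "tilted_form e f a x \<noteq> 0" for x
  proof -
    have form_lim: "(\<lambda>n. tilted_form e f (u n) x) \<longlonglongrightarrow> tilted_form e f a x"
      unfolding tilted_form_def using r by (intro tendsto_intros lim) auto
    show ?thesis
    proof (cases "tilted_form e f a x > 0")
      case True
      from order_tendstoD(1)[OF form_lim this] show ?thesis
        by eventually_elim (use True in simp)
    next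
      case False
      with that have "tilted_form e f a x < 0" by simp
      from order_tendstoD(2)[OF form_lim this] show ?thesis
        by eventually_elim (use False in simp)
    qed
  qed
  show "(\<lambda>n. tilted_curvature s e f (u n)) \<longlonglongrightarrow> tilted_curvature s e f a"
    unfolding tilted_curvature_def
  proof (rule integral_dominated_convergence[where w="?w"])
    show "integrable lborel ?w"
      using integrable_sym_kernel[OF e f l s] integrable_sym_kernel[OF e f r(1) s]
      by (intro Bochner_Integration.integrable_add integrable_abs)
    show "AE x in lborel. norm (sym_kernel s e f (u i) x) \<le> ?w x" for i
    proof (intro AE_I2)
      fix x
      have "sym_kernel s e f (u i) x \<le> sym_kernel s e f l x" "sym_kernel s e f r x \<le> sym_kernel s e f (u i) x"
        using u n l up by (auto intro!: sym_kernel_antimono)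
      then show "norm (sym_kernel s e f (u i) x) \<le> ?w x" by simp
    qed
    show "AE x in lborel. (\<lambda>i. sym_kernel s e f (u i) x) \<longlonglongrightarrow> sym_kernel s e f a x"
      using AE_tilted_form_nonzero[OF n r(2)]
    proof eventually_elim
      case (elim x)
      from elim have "tilted_form e f a x \<noteq> 0" "tilted_form e f a (flip f x) \<noteq> 0" by simp_all
      from this[THEN sgn]
      have "eventually (\<lambda>n. sym_kernel s e f (u n) x = sym_kernel s e f a x) sequentially"
        by eventually_elim (simp only: sym_kernel_eq[OF n(2)])
      then show ?case by (rule tendsto_eventually)
    qed
  qed simp_all
qed

section \<open>Sign of the curvature for very small and very large slopes\<close>

lemma eventually_tilted_form_sign:
  fixes e :: "'a::euclidean_space" and f :: "'b::euclidean_space"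
  assumes n: "norm e = 1" "norm f = 1" and x: "snd x \<bullet> f \<noteq> 0"
  shows "eventually (\<lambda>n. tilted_form e f (1 / real (Suc n)) x > 0) sequentially"
    and "eventually (\<lambda>n. tilted_form e f (real (Suc n)) x < 0) sequentially"
proof -
  \<comment> \<open>For \<open>v\<close> nonzero both \<open>c\<close> and \<open>z\<close> are
    positive, so in \<open>a + z / t - t * c\<close> the term \<open>z / t\<close> wins as
    \<open>t\<close> tends to 0 and \<open>- t * c\<close> wins as \<open>t\<close> tends to
    infinity.\<close>
  define a c z where "a = 2 * (fst x \<bullet> e) * (snd x \<bullet> f)"
    and "c = (norm (fst x))\<^sup>2 - (fst x \<bullet> e)\<^sup>2 + (snd x \<bullet> f)\<^sup>2" and "z = (norm (snd x))\<^sup>2"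
  have "(fst x \<bullet> e)\<^sup>2 \<le> (norm (fst x))\<^sup>2"
    by (rule inner_unit_sq_le[OF n(1)])
  then have c: "c > 0" using x by (simp add: c_def add_nonneg_pos)
  have z: "z > 0" using x by (auto simp: z_def)
  have form: "tilted_form e f t x = a + z / t - t * c" for t
    by (simp add: tilted_form_def a_def c_def z_def)
  have large: "eventually (\<lambda>n. b < real n) sequentially" for b
    using filterlim_real_sequentially by (simp add: filterlim_at_top_dense)
  show "eventually (\<lambda>n. tilted_form e f (1 / real (Suc n)) x > 0) sequentially"
    using large[of "(c - a) / z"]
  proof eventually_elim
    case (elim n)
    then have "c - a < z * real n" using z by (simp add: pos_divide_less_eq mult.commute)
    moreover have "c / real (Suc n) \<le> c" using c by (simp add: divide_le_eq)
    moreover have "tilted_form e f (1 / real (Suc n)) x = a + z * real n + z - c / real (Suc n)"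
      by (simp add: form distrib_left)
    ultimately show ?case using z by linarith
  qed
  show "eventually (\<lambda>n. tilted_form e f (real (Suc n)) x < 0) sequentially"
    using large[of "(z + a) / c"]
  proof eventually_elim
    case (elim n)
    then have "z + a < c * real n" using c by (simp add: pos_divide_less_eq mult.commute)
    moreover have "z / real (Suc n) \<le> z" using z by (simp add: divide_le_eq)
    moreover have "tilted_form e f (real (Suc n)) x = a + z / real (Suc n) - (c * real n + c)"
      by (simp add: form algebra_simps)
    ultimately show ?case using c by linarith
  qed
qed

lemma AE_snd_inner_nonzero:
  fixes f :: "'b::euclidean_space"
  assumes "f \<noteq> 0"
  shows "AE x in (lborel :: ('a::euclidean_space \<times> 'b) measure). snd x \<bullet> f \<noteq> 0"
proof -
  have "negligible {x :: 'a \<times> 'b. (0, f) \<bullet> x = 0}"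
    by (rule negligible_hyperplane) (use assms in \<open>simp add: prod_eq_iff\<close>)
  then have "{x :: 'a \<times> 'b. (0, f) \<bullet> x = 0} \<in> null_sets lebesgue"
    by (simp only: negligible_iff_null_sets)
  moreover have "{x :: 'a \<times> 'b. (0, f) \<bullet> x = 0} \<in> sets lborel"
    by (simp add: closed_hyperplane)
  ultimately have "{x :: 'a \<times> 'b. (0, f) \<bullet> x = 0} \<in> null_sets lborel"
    by (simp only: null_sets_completion_iff)
  then have "AE x :: 'a \<times> 'b in lborel. x \<notin> {x. (0, f) \<bullet> x = 0}" by (rule AE_not_in)
  then show ?thesis
    by eventually_elim (simp add: inner_prod_def inner_commute)
qed

lemma
  fixes e :: "'a::euclidean_space" and f :: "'b::euclidean_space"
  assumes e: "e \<in> Basis" and f: "f \<in> Basis" and s: "0 < s" "s < 1"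
  shows tilted_curvature_pos: "\<exists>t>0. tilted_curvature s e f t > 0"
    and tilted_curvature_neg: "\<exists>t>0. tilted_curvature s e f t < 0"
proof -
  have n: "norm e = 1" "norm f = 1" using e f by auto
  let ?K = "\<lambda>x :: 'a \<times> 'b. 1 / dist x (e, 0) powr (real DIM('a \<times> 'b) + s)"
  have not_int: "\<not> integrable lborel ?K"
    using not_integrable_inverse_dist_powr[OF s(1), of "(e, 0) :: 'a \<times> 'b"] .
  \<comment> \<open>Monotone convergence: increasing functions with integrals bounded by 0 would
    have an integrable limit, but \<open>?K\<close> is not integrable. Both signs are obtained by
    refuting such a bound.\<close>
  have no_bound: False
    if g: "\<And>i. integrable lborel (g i)" "\<And>x. mono (\<lambda>i. g i x)" "AE x in lborel. (\<lambda>i. g i x) \<longlonglongrightarrow> ?K x"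
      and B: "\<And>i. integral\<^sup>L lborel (g i) \<le> 0" for g :: "nat \<Rightarrow> 'a \<times> 'b \<Rightarrow> real"
  proof -
    have "incseq (\<lambda>i. integral\<^sup>L lborel (g i))"
      using g(2) by (intro incseq_SucI integral_mono g(1)) (auto simp: mono_def)
    then obtain L where "(\<lambda>i. integral\<^sup>L lborel (g i)) \<longlonglongrightarrow> L"
      using B incseq_convergent by (metis (no_types))
    then have "integrable lborel ?K"
      using g by (intro integrable_monotone_convergence[of lborel g ?K L]) auto
    with not_int show False by simp
  qed
  have fnz: "f \<noteq> 0" using f by auto
  have flip_nz: "snd (flip f x) \<bullet> f \<noteq> 0" if "snd x \<bullet> f \<noteq> 0" for x :: "'a \<times> 'b"
    using that by (simp add: snd_flip_inner[OF n(2)])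
  show "\<exists>t>0. tilted_curvature s e f t > 0"
  proof (rule ccontr)
    assume *: "\<not> ?thesis"
    show False
    proof (rule no_bound[of "\<lambda>i. sym_kernel s e f (1 / real (Suc i))"])
      show "integrable lborel (sym_kernel s e f (1 / real (Suc i)))" for i
        by (rule integrable_sym_kernel[OF e f _ s]) simp
      show "mono (\<lambda>i. sym_kernel s e f (1 / real (Suc i)) x)" for x
        using n by (intro monoI sym_kernel_antimono) (auto simp: frac_le)
      show "integral\<^sup>L lborel (sym_kernel s e f (1 / real (Suc i))) \<le> 0" for i
        using *[unfolded not_ex, rule_format, of "1 / real (Suc i)"]
        by (simp add: tilted_curvature_def not_less del: of_nat_Suc)
      show "AE x in lborel. (\<lambda>i. sym_kernel s e f (1 / real (Suc i)) x) \<longlonglongrightarrow> ?K x"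
        using AE_snd_inner_nonzero[OF fnz]
      proof eventually_elim
        case (elim x)
        have "eventually (\<lambda>i. sym_kernel s e f (1 / real (Suc i)) x = ?K x) sequentially"
          using eventually_tilted_form_sign(1)[OF n elim] eventually_tilted_form_sign(1)[OF n flip_nz[OF elim]]
          by eventually_elim (simp add: sym_kernel_eq[OF n(2)] del: of_nat_Suc)
        then show ?case by (rule tendsto_eventually)
      qed
    qed
  qed
  show "\<exists>t>0. tilted_curvature s e f t < 0"
  proof (rule ccontr)
    assume *: "\<not> ?thesis"
    show False
    \<comment> \<open>For growing slopes it is the negated kernel that increases to
      \<open>?K\<close>.\<close>
    proof (rule no_bound[of "\<lambda>i x. - sym_kernel s e f (real (Suc i)) x"])
      show "integrable lborel (\<lambda>x. - sym_kernel s e f (real (Suc i)) x)" for i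
        by (intro integrable_minus integrable_sym_kernel[OF e f _ s]) simp
      show "mono (\<lambda>i. - sym_kernel s e f (real (Suc i)) x)" for x
        using n by (intro monoI le_imp_neg_le sym_kernel_antimono) auto
      show "(LINT x|lborel. - sym_kernel s e f (real (Suc i)) x) \<le> 0" for i
        using *[unfolded not_ex, rule_format, of "real (Suc i)"]
        by (simp add: tilted_curvature_def not_less del: of_nat_Suc)
      show "AE x in lborel. (\<lambda>i. - sym_kernel s e f (real (Suc i)) x) \<longlonglongrightarrow> ?K x"
        using AE_snd_inner_nonzero[OF fnz]
      proof eventually_elim
        case (elim x)
        have "eventually (\<lambda>i. - sym_kernel s e f (real (Suc i)) x = ?K x) sequentially"
          using eventually_tilted_form_sign(2)[OF n elim] eventually_tilted_form_sign(2)[OF n flip_nz[OF elim]]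
          by eventually_elim (simp add: sym_kernel_eq[OF n(2)] del: of_nat_Suc)
        then show ?case by (rule tendsto_eventually)
      qed
    qed
  qed
qed

lemma tilted_curvature_zero:
  fixes e :: "'a::euclidean_space" and f :: "'b::euclidean_space"
  assumes e: "e \<in> Basis" and f: "f \<in> Basis" and s: "0 < s" "s < 1"
  shows "\<exists>!t. 0 < t \<and> tilted_curvature s e f t = 0"
proof -
  obtain l r where l: "0 < l" "tilted_curvature s e f l > 0" and r: "0 < r" "tilted_curvature s e f r < 0"
    using tilted_curvature_pos[OF assms] tilted_curvature_neg[OF assms] by blast
  \<comment> \<open>The endpoints come from independent existence claims; strict monotonicity puts
    them in the order that the intermediate value theorem requires.\<close>
  have "l \<le> r"
  proof (rule ccontr)
    assume "\<not> l \<le> r"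
    then have "tilted_curvature s e f l < tilted_curvature s e f r"
      using r by (intro tilted_curvature_strict_antimono[OF e f s]) auto
    with l r show False by simp
  qed
  then obtain t where "l \<le> t" "t \<le> r" "tilted_curvature s e f t = 0"
    using IVT2'[of "tilted_curvature s e f" r 0 l] l r tilted_curvature_continuous[OF e f s l(1), of r] by auto
  with l have "0 < t \<and> tilted_curvature s e f t = 0" by simp
  moreover have "t1 = t2" if "0 < t1 \<and> tilted_curvature s e f t1 = 0" "0 < t2 \<and> tilted_curvature s e f t2 = 0" for t1 t2
    using that tilted_curvature_strict_antimono[OF e f s, of t1 t2] tilted_curvature_strict_antimono[OF e f s, of t2 t1]
    by (cases t1 t2 rule: linorder_cases) auto
  ultimately show ?thesis by blast
qed

section \<open>Nonlocal minimal cones\<close>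

lemma has_nonlocal_mean_curvature_tilted_set:
  fixes e :: "'a::euclidean_space" and f :: "'b::euclidean_space"
  assumes e: "e \<in> Basis" and f: "f \<in> Basis" and s: "0 < s" "s < 1" and t: "0 < t"
  shows "has_nonlocal_mean_curvature s (tilted_set e f t) (e, 0) (tilted_curvature s e f t)"
  unfolding tilted_curvature_def sym_kernel_def
proof (rule has_nonlocal_mean_curvature_symmetrize[OF tilted_set_borel s(1)])
  show "orthogonal_transformation (flip f)"
    using f by (simp add: orthogonal_transformation linear_flip norm_flip)
  show "flip f (e, 0) = (e, 0)" by (simp add: flip_def)
  show "integrable lborel (\<lambda>x. (nmc_kernel s (tilted_set e f t) (e, 0) x + nmc_kernel s (tilted_set e f t) (e, 0) (flip f x)) / 2)"
    using integrable_sym_kernel[OF e f t s] by (simp add: sym_kernel_def[abs_def])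
qed

lemma cone_set_borel: "(cone_set t :: ((real^'m) \<times> (real^'n)) set) \<in> sets borel"
proof -
  have "(cone_set t :: ((real^'m) \<times> (real^'n)) set) = {x. t * norm (fst x) < norm (snd x)}"
    by (auto simp: cone_set_def)
  then show ?thesis
    by (simp only:) (intro borel_open open_Collect_less continuous_intros)
qed

text \<open>Dilations and rotations of each factor preserve the cone and act transitively on its
  nonzero points. Composed with \<open>tilt\<close> they give a similarity of ratio
  \<open>norm p\<close> that carries \<open>(e, 0)\<close> to \<open>p\<close> and pulls the cone's
  set back to \<open>tilted_set\<close>.\<close>

lemma has_nonlocal_mean_curvature_cone_set:
  fixes e :: "real^'m" and f :: "real^'n" and p :: "(real^'m) \<times> (real^'n)"
  assumes e: "e \<in> Basis" and f: "f \<in> Basis" and s: "0 < s" "s < 1" and t: "0 < t"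
    and p: "p \<in> cone t - {0}"
  shows "has_nonlocal_mean_curvature s (cone_set t) p (tilted_curvature s e f t / norm p powr s)"
proof -
  obtain y z where yz: "p = (y, z)" "norm z = t * norm y"
    using p by (auto simp: cone_def)
  have n: "norm e = 1" "norm f = 1" using e f by auto
  have "y \<noteq> 0"
    using p yz by (auto simp: zero_prod_def)
  then have ny: "norm y > 0" and nz: "norm z > 0"
    using t unfolding yz(2) by simp_all
  obtain A where A: "orthogonal_transformation A" "A e = y /\<^sub>R norm y"
    using n ny by (auto intro: orthogonal_transformation_exists[of e "y /\<^sub>R norm y"])
  obtain B where B: "orthogonal_transformation B" "B f = z /\<^sub>R norm z"
    using n nz by (auto intro: orthogonal_transformation_exists[of f "z /\<^sub>R norm z"])
  note AB = A(1)[unfolded orthogonal_transformation] B(1)[unfolded orthogonal_transformation]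
  define T where "T x = norm p *\<^sub>R (A (fst (tilt e f t x)), B (snd (tilt e f t x)))" for x
  \<comment> \<open>The factor \<open>sqrt (1 + t\<^sup>2)\<close> cancels the normalisation in
    \<open>tilt\<close>, so that \<open>T (e, 0)\<close> is exactly \<open>p\<close>.\<close>
  have np: "norm p = norm y * sqrt (1 + t\<^sup>2)"
  proof -
    have "(norm p)\<^sup>2 = (norm y * sqrt (1 + t\<^sup>2))\<^sup>2"
      by (simp add: yz norm_prod_def power_mult_distrib algebra_simps)
    then show ?thesis by (simp only: power2_eq_iff_nonneg norm_ge_zero mult_nonneg_nonneg real_sqrt_ge_zero add_nonneg_nonneg zero_le_one zero_le_power2)
  qed
  have "linear T"
    using linear_tilt[of e f t] AB
    by (intro linearI) (simp_all add: T_def linear_add linear_scale scaleR_add_right)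
  moreover have npos: "0 < norm p" using p by simp
  moreover have "norm (T x) = norm p * norm x" for x
  proof -
    have "norm (A (fst (tilt e f t x)), B (snd (tilt e f t x))) = norm (tilt e f t x)"
      using AB by (simp add: norm_Pair norm_prod_def[of "tilt e f t x"])
    then show ?thesis by (simp only: T_def norm_scaleR norm_tilt[OF n] abs_norm_cancel)
  qed
  moreover have "T -` cone_set t = tilted_set e f t"
  proof (intro set_eqI)
    fix x
    have "x \<in> T -` cone_set t \<longleftrightarrow> norm p * norm (snd (tilt e f t x)) > t * (norm p * norm (fst (tilt e f t x)))"
      using AB by (simp add: T_def cone_set_def)
    also have "\<dots> \<longleftrightarrow> norm p * norm (snd (tilt e f t x)) > norm p * (t * norm (fst (tilt e f t x)))"
      by (simp only: mult.left_commute)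
    also have "\<dots> \<longleftrightarrow> x \<in> tilted_set e f t"
      using npos by (simp only: mult_less_cancel_left_pos tilted_set_def mem_Collect_eq tilted_form_pos_iff[OF n t])
    finally show "x \<in> T -` cone_set t \<longleftrightarrow> x \<in> tilted_set e f t" .
  qed
  ultimately have "has_nonlocal_mean_curvature s (cone_set t) (T (e, 0)) (tilted_curvature s e f t / norm p powr s)"
    using has_nonlocal_mean_curvature_tilted_set[OF e f s t]
    by (intro has_nonlocal_mean_curvature_similarity cone_set_borel s) simp_all
  moreover have "T (e, 0) = p"
  proof -
    have w: "sqrt (1 + t\<^sup>2) > 0" by (simp add: add_pos_nonneg)
    have "tilt e f t (e, 0) = ((1 / sqrt (1 + t\<^sup>2)) *\<^sub>R e, (t / sqrt (1 + t\<^sup>2)) *\<^sub>R f)"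
      using n by (simp add: tilt_def dot_square_norm scaleR_diff_left)
    then have "T (e, 0) = ((norm p / (sqrt (1 + t\<^sup>2) * norm y)) *\<^sub>R y, (norm p * t / (sqrt (1 + t\<^sup>2) * norm z)) *\<^sub>R z)"
      using A B by (simp add: T_def orthogonal_transformation_scaleR divide_inverse mult.assoc)
    moreover have "norm p / (sqrt (1 + t\<^sup>2) * norm y) = 1" "norm p * t / (sqrt (1 + t\<^sup>2) * norm z) = 1"
      using w ny t unfolding np yz(2) by simp_all
    ultimately show ?thesis by (simp only: yz(1) scaleR_one)
  qed
  ultimately show ?thesis by simp
qed

lemma has_nonlocal_mean_curvature_unique:
  "has_nonlocal_mean_curvature s E p H \<Longrightarrow> has_nonlocal_mean_curvature s E p H' \<Longrightarrow> H = H'"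
  unfolding has_nonlocal_mean_curvature_def by (metis tendsto_unique trivial_limit_at_right_real)

text \<open>At every nonzero boundary point the curvature is a positive multiple of one number, so
  the condition at all points is a single equation in \<open>t\<close>.\<close>

lemma cone_minimal_iff:
  fixes e :: "real^'m" and f :: "real^'n"
  assumes e: "e \<in> Basis" and f: "f \<in> Basis" and s: "0 < s" "s < 1" and t: "0 < t"
  shows "(\<forall>p \<in> (cone t :: ((real^'m) \<times> (real^'n)) set) - {0}. has_nonlocal_mean_curvature s (cone_set t) p 0)
    \<longleftrightarrow> tilted_curvature s e f t = 0"
proof
  assume "tilted_curvature s e f t = 0"
  then show "\<forall>p \<in> (cone t :: ((real^'m) \<times> (real^'n)) set) - {0}. has_nonlocal_mean_curvature s (cone_set t) p 0"
    using has_nonlocal_mean_curvature_cone_set[OF assms] by fastforce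
next
  \<comment> \<open>One sample point of the cone suffices, since principal values are
    unique.\<close>
  let ?p = "(e, t *\<^sub>R f)"
  assume *: "\<forall>p \<in> (cone t :: ((real^'m) \<times> (real^'n)) set) - {0}. has_nonlocal_mean_curvature s (cone_set t) p 0"
  have p: "?p \<in> cone t - {0}"
    using e f t by (auto simp: cone_def zero_prod_def)
  then have "norm ?p powr s > 0" by simp
  moreover have "tilted_curvature s e f t / norm ?p powr s = 0"
    using has_nonlocal_mean_curvature_cone_set[OF assms p] bspec[OF * p]
    by (rule has_nonlocal_mean_curvature_unique)
  ultimately show "tilted_curvature s e f t = 0" by simp
qed

theorem theorem1:
  fixes s :: real
  assumes "0 < s" and "s < 1"
  shows "\<exists>!\<alpha>::real. 0 < \<alpha> \<and>
           (\<forall>p \<in> (cone \<alpha> :: ((real^'m) \<times> (real^'n)) set) - {0}.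
              has_nonlocal_mean_curvature s (cone_set \<alpha> :: ((real^'m) \<times> (real^'n)) set) p 0)"
proof -
  obtain e :: "real^'m" where e: "e \<in> Basis"
    using nonempty_Basis by blast
  obtain f :: "real^'n" where f: "f \<in> Basis"
    using nonempty_Basis by blast
  show ?thesis
    using tilted_curvature_zero[OF e f assms] cone_minimal_iff[OF e f assms] by (simp cong: conj_cong)
qed

end
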